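(* Let $\alpha>0$, let $n$ be the smallest integer greater than or equal to $\alpha$, let $m\ge n$ be an integer and let $l\ge1$ be an integer. Then for $t>0$, $$D_{0+}^{\alpha}B_m^{(l)}(t)=\frac{\Gamma(m+1)}{\Gamma(m-n+1)}\sum_{k=0}^{m-n}\frac{k!\binom{m-n}{k}}{\Gamma(n+k-\alpha+1)}\,t^{k-\alpha+n}\left(\sum_{\substack{s_1+s_2+\cdots+s_l=m-n-k\\ s_1,\dots,s_l\ge0}}\binom{m-n-k}{s_1,s_2,\dots,s_l}\prod_{j=1}^{l}B_{s_j}\right).$$
   Context: The Caputo fractional derivative of order $\alpha>0$ is $D_{0+}^\alpha y(t)=\frac{1}{\Gamma(n-\alpha)}\int_0^t\frac{y^{(n)}(s)}{(t-s)^{\alpha-n+1}}ds$, where $n$ is the smallest integer greater than or equal to $\alpha$ (for $\alpha=n$ it is the ordinary derivative $y^{(n)}$). The Bernoulli polynomials of order $l$ are defined by $\left(\frac{z}{e^z-1}\right)^l e^{tz}=\sum_{m=0}^\infty B_m^{(l)}(t)\frac{z^m}{m!}$ for $|z|<2\pi$. The Bernoulli numbers $B_m$ are defined by $\frac{z}{e^z-1}=\sum_{m=0}^\infty B_m\frac{z^m}{m!}$. Here $\binom{N}{s_1,\dots,s_l}=\frac{N!}{s_1!\cdots s_l!}$ is the multinomial coefficient. *)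

theory Defs
  imports "HOL-Complex_Analysis.Complex_Analysis"
begin

text \<open>
  Caputo derivative with base point 0. The order is \<open>\<alpha> > 0\<close> and \<open>nat \<lceil>\<alpha>\<rceil>\<close> is the smallest integer
  greater than or equal to \<open>\<alpha>\<close>. The value of the integrand at \<open>s = t\<close> is irrelevant.
\<close>

definition caputo :: "real \<Rightarrow> (real \<Rightarrow> real) \<Rightarrow> real \<Rightarrow> real" where
  "caputo \<alpha> y t = (let n = nat \<lceil>\<alpha>\<rceil> in
     if \<alpha> = real n then (deriv ^^ n) y t
     else 1 / Gamma (real n - \<alpha>) *
            integral {0..t} (\<lambda>s. (deriv ^^ n) y s / (t - s) powr (\<alpha> - real n + 1)))"

text \<open>
  The sequence \<open>c\<close> is given by the exponential generating function \<open>F\<close> on the disc of radius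
  \<open>2\<pi>\<close>. The centre is left out because the generating functions below have a removable
  singularity there; the coefficients are nevertheless determined uniquely.
\<close>

definition has_egf :: "(nat \<Rightarrow> real) \<Rightarrow> (complex \<Rightarrow> complex) \<Rightarrow> bool" where
  "has_egf c F \<longleftrightarrow> (\<forall>z. z \<noteq> 0 \<and> norm z < 2 * pi \<longrightarrow>
     (\<lambda>m. of_real (c m) * z ^ m / fact m) sums F z)"

definition bernoulli_poly :: "nat \<Rightarrow> nat \<Rightarrow> real \<Rightarrow> real" where
  "bernoulli_poly l m t =
     (THE c. has_egf c (\<lambda>z. (z / (exp z - 1)) ^ l * exp (of_real t * z))) m"

definition bernoulli :: "nat \<Rightarrow> real" where
  "bernoulli m = (THE c. has_egf c (\<lambda>z. z / (exp z - 1))) m"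

definition multinomial :: "nat \<Rightarrow> nat list \<Rightarrow> real" where
  "multinomial N s = fact N / (\<Prod>i<length s. fact (s ! i))"

text \<open>The two definite descriptions above are well-defined.\<close>

lemma powser_punctured_unique:
  fixes a b :: "nat \<Rightarrow> complex"
  assumes r: "r > 0"
    and a: "\<And>z. z \<noteq> 0 \<Longrightarrow> norm z < r \<Longrightarrow> (\<lambda>m. a m * z ^ m) sums F z"
    and b: "\<And>z. z \<noteq> 0 \<Longrightarrow> norm z < r \<Longrightarrow> (\<lambda>m. b m * z ^ m) sums F z"
  shows "a = b"
proof -
  define d where "d = (\<lambda>m. a m - b m)"
  have d: "(\<lambda>m. d m * z ^ m) sums 0" if "z \<noteq> 0" "norm z < r" for z
    using sums_diff[OF a[OF that] b[OF that]] by (simp add: d_def algebra_simps)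
  have "((\<lambda>_. 0) \<longlongrightarrow> d 0) (at (0::complex))"
    by (rule powser_limit_0_strong[OF r]) (use d in auto)
  hence d0: "d 0 = 0"
    by (simp add: tendsto_const_iff)
  have d': "(\<lambda>m. d m * (z - 0) ^ m) sums 0" if "norm (z - 0) < r" for z
  proof (cases "z = 0")
    case True
    have "(\<lambda>m. d m * 0 ^ m) sums d 0"
      by (rule powser_sums_zero)
    thus ?thesis using True d0 by simp
  next
    case False
    thus ?thesis using d[of z] that by simp
  qed
  have "d m = 0" for m
  proof (rule ccontr)
    assume m: "d m \<noteq> 0"
    with d0 have "m > 0" by (cases m) auto
    obtain s :: real where s: "s > 0" "\<And>z::complex. z \<in> cball 0 s - {0} \<Longrightarrow> (0::complex) \<noteq> 0"
      using powser_0_nonzero[where r = r and a = d and \<xi> = 0 and f = "\<lambda>_. 0" and m = m]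
        r d' m \<open>m > 0\<close> by blast
    have "complex_of_real s \<in> cball 0 s - {0}" using s(1) by auto
    thus False using s(2) by blast
  qed
  thus ?thesis by (auto simp: d_def fun_eq_iff)
qed

lemma has_egf_unique:
  assumes "has_egf c F" "has_egf d F"
  shows "c = d"
proof -
  have "(\<lambda>m. complex_of_real (c m) / fact m) = (\<lambda>m. complex_of_real (d m) / fact m)"
    by (rule powser_punctured_unique[of "2 * pi" _ F])
       (use assms in \<open>auto simp: has_egf_def\<close>)
  thus ?thesis by (auto simp: fun_eq_iff)
qed

lemma has_egf_bernoulli_poly_exists:
  "\<exists>c. has_egf c (\<lambda>z. (z / (exp z - 1)) ^ l * exp (of_real t * z))" (is "\<exists>c. has_egf c ?F")
proof -
  define D where "D = ball (0::complex) (2 * pi)"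
  have nz: "exp z \<noteq> 1" if "z \<in> D" "z \<noteq> 0" for z :: complex
  proof
    assume "exp z = 1"
    then obtain k :: int where k: "Re z = 0" "Im z = of_int (2 * k) * pi"
      by (auto simp: exp_eq_1)
    have "\<bar>Im z\<bar> < 2 * pi"
      using that abs_Im_le_cmod[of z] by (simp add: D_def)
    with k have "\<bar>of_int k\<bar> * (2 * pi) < 1 * (2 * pi)"
      by (simp add: abs_mult)
    hence "\<bar>real_of_int k\<bar> < 1"
      by (simp only: mult_less_cancel_right) auto
    hence "k = 0" by linarith
    with k that show False by (simp add: complex_eq_iff)
  qed
  have "(\<lambda>z::complex. z / (exp z - 1)) \<midarrow>0\<rightarrow> 1"
  proof -
    have "((\<lambda>z::complex. (exp z - 1) / z) \<longlongrightarrow> 1) (at 0)"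
      using DERIV_exp[of "0::complex"] by (simp add: DERIV_def)
    from tendsto_inverse[OF this] show ?thesis by simp
  qed
  hence holG: "(\<lambda>z::complex. if z = 0 then 1 else z / (exp z - 1)) holomorphic_on D"
    by (intro removable_singularity holomorphic_intros) (use nz in \<open>auto simp: D_def\<close>)
  define H where
    "H = (\<lambda>z::complex. (if z = 0 then 1 else z / (exp z - 1)) ^ l * exp (of_real t * z))"
  have holH: "H holomorphic_on D"
    unfolding H_def by (intro holomorphic_intros holG)
  define a where "a = (\<lambda>m. (deriv ^^ m) H 0 / fact m)"
  have a: "(\<lambda>m. a m * z ^ m) sums ?F z" if "z \<noteq> 0" "norm z < 2 * pi" for z
    using holomorphic_power_series[OF holH[unfolded D_def], of z] that
    by (simp add: a_def H_def)
  have "(\<lambda>m. cnj (a m)) = a"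
  proof (rule powser_punctured_unique[of "2 * pi" _ ?F])
    fix z :: complex assume z: "z \<noteq> 0" "norm z < 2 * pi"
    have "(\<lambda>m. cnj (a m * cnj z ^ m)) sums cnj (?F (cnj z))"
      using a[of "cnj z"] z by (subst sums_cnj) auto
    thus "(\<lambda>m. cnj (a m) * z ^ m) sums ?F z"
      by (simp add: exp_cnj)
  qed (use a in auto)
  hence "of_real (Re (a m)) = a m" for m
    by (metis Reals_cnj_iff of_real_Re)
  hence "has_egf (\<lambda>m. fact m * Re (a m)) ?F"
    unfolding has_egf_def using a by simp
  thus ?thesis by blast
qed

lemma has_egf_the:
  assumes "\<exists>c. has_egf c F"
  shows "has_egf (THE c. has_egf c F) F"
proof -
  from assms obtain c where "has_egf c F" by blast
  thus ?thesis by (rule theI[where P = "\<lambda>c. has_egf c F"]) (rule has_egf_unique[OF _ \<open>has_egf c F\<close>])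
qed

lemma has_egf_bernoulli_poly:
  "has_egf (\<lambda>m. bernoulli_poly l m t) (\<lambda>z. (z / (exp z - 1)) ^ l * exp (of_real t * z))"
  unfolding bernoulli_poly_def by (rule has_egf_the[OF has_egf_bernoulli_poly_exists])

lemma has_egf_bernoulli: "has_egf bernoulli (\<lambda>z. z / (exp z - 1))"
proof -
  have "\<exists>c. has_egf c (\<lambda>z. z / (exp z - 1))"
    using has_egf_bernoulli_poly_exists[of 1 0] by simp
  from has_egf_the[OF this] show ?thesis
    by (simp add: bernoulli_def [abs_def])
qed

end

theory Submission
  imports Defs
begin

text \<open>
  Multiplying generating functions expands \<open>bernoulli_poly l m t\<close> in powers of \<open>t\<close>, with the coefficients of
  the \<open>l\<close>-th power of the Bernoulli series given by the multinomial sums. These polynomials form an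
  Appell sequence, so \<open>n\<close> derivatives only lower the index to \<open>m - n\<close>, and the remaining fractional
  integral of each monomial is a Beta integral.
\<close>

text \<open>Power series that converge on the disc converge absolutely inside it, so the Cauchy
  product applies. The factor \<open>fact m\<close> converts ordinary coefficients into exponential
  ones, so products of generating functions can be computed in the ring
  \<open>real fps\<close>.\<close>

lemma has_egf_fps_mult:
  assumes "has_egf (\<lambda>m. fact m * fps_nth A m) F" "has_egf (\<lambda>m. fact m * fps_nth B m) G"
  shows "has_egf (\<lambda>m. fact m * fps_nth (A * B) m) (\<lambda>z. F z * G z)"
proof -
  have norm_summable: "summable (\<lambda>m. norm (of_real (fps_nth C m) * z ^ m :: complex))"
    if "has_egf (\<lambda>m. fact m * fps_nth C m) H" "norm z < 2 * pi" for C H and z :: complex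
  proof (rule powser_insidea)
    \<comment> \<open>A point with modulus midway between \<open>norm z\<close> and the radius:
      convergence there forces absolute convergence at \<open>z\<close>. It is nonzero even for
      \<open>z = 0\<close>, where \<open>has_egf\<close> asserts nothing.\<close>
    define w where "w = complex_of_real ((norm z + 2 * pi) / 2)"
    have nw: "norm w = (norm z + 2 * pi) / 2"
      unfolding w_def norm_of_real by (simp add: add_nonneg_nonneg)
    then have "w \<noteq> 0" "norm w < 2 * pi"
      using that(2) pi_gt_zero norm_ge_zero[of z] by (auto simp del: norm_ge_zero)
    then show "summable (\<lambda>m. of_real (fps_nth C m) * w ^ m)"
      using that(1) by (auto simp: has_egf_def dest!: spec[of _ w] intro: sums_summable)
    show "norm z < norm w" using that(2) nw by simp
  qed
  show ?thesis
    unfolding has_egf_def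
  proof (intro allI impI, elim conjE)
    fix z :: complex assume z: "z \<noteq> 0" "norm z < 2 * pi"
    have "(\<lambda>m. \<Sum>i\<le>m. (of_real (fps_nth A i) * z ^ i) * (of_real (fps_nth B (m - i)) * z ^ (m - i)))
        sums ((\<Sum>m. of_real (fps_nth A m) * z ^ m) * (\<Sum>m. of_real (fps_nth B m) * z ^ m))"
      by (intro Cauchy_product_sums norm_summable[OF assms(1)] norm_summable[OF assms(2)] z)
    moreover have "(\<Sum>m. of_real (fps_nth A m) * z ^ m) = F z" "(\<Sum>m. of_real (fps_nth B m) * z ^ m) = G z"
      using assms z by (auto simp: has_egf_def sums_iff)
    moreover have "(\<Sum>i\<le>m. (of_real (fps_nth A i) * z ^ i) * (of_real (fps_nth B (m - i)) * z ^ (m - i)))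
        = of_real (fact m * fps_nth (A * B) m) * z ^ m / fact m" for m
    proof -
      have "(of_real (fps_nth A i) * z ^ i) * (of_real (fps_nth B (m - i)) * z ^ (m - i))
          = of_real (fps_nth A i * fps_nth B (m - i)) * z ^ m" if "i \<le> m" for i
        using power_add[of z i "m - i"] that by (simp add: mult_ac)
      then have "(\<Sum>i\<le>m. (of_real (fps_nth A i) * z ^ i) * (of_real (fps_nth B (m - i)) * z ^ (m - i)))
          = (\<Sum>i\<le>m. of_real (fps_nth A i * fps_nth B (m - i)) * z ^ m)"
        by (intro sum.cong) auto
      also have "\<dots> = of_real (fps_nth (A * B) m) * z ^ m"
        by (simp add: fps_mult_nth atLeast0AtMost sum_distrib_right)
      finally show ?thesis by simp
    qed
    ultimately show "(\<lambda>m. of_real (fact m * fps_nth (A * B) m) * z ^ m / fact m) sums (F z * G z)"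
      by simp
  qed
qed

lemma has_egf_fps_one: "has_egf (\<lambda>m. fact m * fps_nth 1 m) (\<lambda>z. 1)"
  unfolding has_egf_def
proof (intro allI impI)
  fix z :: complex
  have "(\<lambda>m. of_real (fact m * fps_nth 1 m) * z ^ m / fact m) = (\<lambda>m. if m = 0 then 1 else 0)"
    by auto
  then show "(\<lambda>m. of_real (fact m * fps_nth 1 m) * z ^ m / fact m) sums 1"
    using sums_single[of 0 "\<lambda>_. 1::complex"] by simp
qed

lemma has_egf_fps_power:
  assumes "has_egf (\<lambda>m. fact m * fps_nth A m) F"
  shows "has_egf (\<lambda>m. fact m * fps_nth (A ^ l) m) (\<lambda>z. F z ^ l)"
proof (induction l)
  case 0
  then show ?case using has_egf_fps_one by simp
next
  case (Suc l)
  then show ?case using has_egf_fps_mult[OF assms Suc] by simp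
qed

lemma has_egf_fps_exp: "has_egf (\<lambda>m. fact m * fps_nth (fps_exp x) m) (\<lambda>z. exp (of_real x * z))"
  unfolding has_egf_def
proof (intro allI impI)
  fix z :: complex
  show "(\<lambda>m. of_real (fact m * fps_nth (fps_exp x) m) * z ^ m / fact m) sums exp (of_real x * z)"
    using exp_converges[of "of_real x * z"]
    by (simp add: scaleR_conv_of_real power_mult_distrib field_simps)
qed

definition bernoulli_fps :: "real fps" where
  "bernoulli_fps = Abs_fps (\<lambda>m. bernoulli m / fact m)"

text \<open>The generating function is exp(xz) times the l-th power of the Bernoulli series, and its
  coefficients are unique. The exponential contributes x^k/k!, and m!/k! = (m choose k) (m-k)!
  leaves the binomial coefficient.\<close>

lemma bernoulli_poly_eq_sum:
  "bernoulli_poly l m x =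
    (\<Sum>k\<le>m. real (m choose k) * (fact (m - k) * fps_nth (bernoulli_fps ^ l) (m - k)) * x ^ k)"
proof -
  have "has_egf (\<lambda>m. fact m * fps_nth bernoulli_fps m) (\<lambda>z. z / (exp z - 1))"
    using has_egf_bernoulli by (simp add: bernoulli_fps_def)
  from has_egf_fps_mult[OF has_egf_fps_exp has_egf_fps_power[OF this]]
  have "has_egf (\<lambda>m. fact m * fps_nth (fps_exp x * bernoulli_fps ^ l) m)
      (\<lambda>z. (z / (exp z - 1)) ^ l * exp (of_real x * z))"
    by (simp add: mult.commute)
  from has_egf_unique[OF has_egf_bernoulli_poly this]
  have "bernoulli_poly l m x = fact m * fps_nth (fps_exp x * bernoulli_fps ^ l) m"
    by (rule fun_cong)
  also have "\<dots> = (\<Sum>k\<le>m. real (m choose k) *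
      (fact (m - k) * fps_nth (bernoulli_fps ^ l) (m - k)) * x ^ k)"
    unfolding fps_mult_nth atLeast0AtMost sum_distrib_left
    by (intro sum.cong refl) (simp add: binomial_fact field_simps)
  finally show ?thesis .
qed

text \<open>A coefficient of an l-fold product is a sum over the lists in
  \<open>natpermute N l\<close>. The factorials dividing the Bernoulli numbers combine with
  \<open>fact N\<close> into the multinomial coefficient.\<close>

lemma fact_mult_bernoulli_fps_power_nth:
  assumes "l \<ge> 1"
  shows "fact N * fps_nth (bernoulli_fps ^ l) N =
    (\<Sum>s\<in>{s :: nat list. length s = l \<and> sum_list s = N}.
        multinomial N s * (\<Prod>j<l. bernoulli (s ! j)))"
proof -
  obtain q where l: "l = Suc q" using assms by (cases l) auto
  have *: "{0..q} = {..<l}" by (auto simp: l)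
  have "fps_nth (bernoulli_fps ^ l) N =
      (\<Sum>s\<in>natpermute N l. \<Prod>j<l. bernoulli (s ! j) / fact (s ! j))"
    unfolding l fps_power_nth_Suc by (simp add: bernoulli_fps_def * l)
  then show ?thesis
    by (auto simp: natpermute_def multinomial_def sum_distrib_left prod_dividef intro!: sum.cong)
qed

text \<open>The Appell property rests on the absorption identity (k+1) C(m+1,k+1) = (m+1) C(m,k).
  The free constant \<open>K\<close> lets the rule be iterated.\<close>

lemma deriv_appell:
  fixes c :: "nat \<Rightarrow> real"
  shows "deriv (\<lambda>x. K * (\<Sum>k\<le>Suc m. real (Suc m choose k) * c (Suc m - k) * x ^ k)) =
    (\<lambda>x. (K * real (Suc m)) * (\<Sum>k\<le>m. real (m choose k) * c (m - k) * x ^ k))"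
proof
  fix x :: real
  have D: "((\<lambda>x. K * (\<Sum>k\<le>Suc m. real (Suc m choose k) * c (Suc m - k) * x ^ k)) has_real_derivative
      K * (\<Sum>k\<le>Suc m. real (Suc m choose k) * c (Suc m - k) * (real k * x ^ (k - 1)))) (at x)"
    by (intro DERIV_cmult DERIV_sum) (auto intro!: derivative_eq_intros)
  have E: "K * (\<Sum>k\<le>Suc m. real (Suc m choose k) * c (Suc m - k) * (real k * x ^ (k - 1))) =
      (K * real (Suc m)) * (\<Sum>k\<le>m. real (m choose k) * c (m - k) * x ^ k)"
  proof -
    have *: "real (Suc k) * real (Suc m choose Suc k) = real (Suc m) * real (m choose k)" for k
      by (metis Suc_times_binomial of_nat_mult)
    have "real (Suc m choose Suc k) * c (m - k) * (real (Suc k) * x ^ k) =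
        real (Suc m) * (real (m choose k) * c (m - k) * x ^ k)" for k
      using arg_cong[OF *, of "\<lambda>y. y * c (m - k) * x ^ k" k] by (simp only: mult_ac)
    \<comment> \<open>Splitting off \<open>k = 0\<close> shifts the index; that term vanishes
      through its factor \<open>real 0\<close>, whatever the truncated exponent \<open>0 - 1\<close>
      gives.\<close>
    then show ?thesis
      by (simp only: sum.atMost_Suc_shift diff_Suc_Suc diff_Suc_1 of_nat_0 mult_zero_left
            mult_zero_right add_0 sum_distrib_left mult.assoc)
  qed
  show "deriv (\<lambda>x. K * (\<Sum>k\<le>Suc m. real (Suc m choose k) * c (Suc m - k) * x ^ k)) x =
      (K * real (Suc m)) * (\<Sum>k\<le>m. real (m choose k) * c (m - k) * x ^ k)"
    by (rule trans[OF DERIV_imp_deriv[OF D] E])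
qed

lemma higher_deriv_appell:
  fixes c :: "nat \<Rightarrow> real"
  shows "(deriv ^^ n) (\<lambda>x. \<Sum>k\<le>N + n. real (N + n choose k) * c (N + n - k) * x ^ k) =
    (\<lambda>x. fact (N + n) / fact N * (\<Sum>k\<le>N. real (N choose k) * c (N - k) * x ^ k))"
proof -
  \<comment> \<open>The innermost derivative is taken first and changes the constant to K (N+n+1),
    so the induction must generalise over \<open>K\<close>.\<close>
  have "(deriv ^^ n) (\<lambda>x. K * (\<Sum>k\<le>N + n. real (N + n choose k) * c (N + n - k) * x ^ k)) =
    (\<lambda>x. K * (fact (N + n) / fact N) * (\<Sum>k\<le>N. real (N choose k) * c (N - k) * x ^ k))" for K
  proof (induction n arbitrary: K)
    case (Suc n)
    show ?case
      unfolding add_Suc_right funpow_Suc_right o_apply deriv_appell Suc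
      by (simp add: mult_ac)
  qed simp
  from this[of 1] show ?thesis by simp
qed

text \<open>The substitution s = tu reduces this to Euler's Beta integral on [0,1].\<close>

lemma has_integral_power_div_powr:
  fixes t b :: real
  assumes t: "t > 0" and b: "b > 0"
  shows "((\<lambda>s. s ^ k / (t - s) powr (1 - b)) has_integral
    Beta (real k + 1) b * t powr (real k + b)) {0..t}"
proof -
  \<comment> \<open>The Beta integrand at u = s/t, in the affine form that
    \<open>has_integral_affinity'\<close> produces. The prefactor and the Jacobian \<open>t\<close>
    together give the power k + b.\<close>
  let ?g = "\<lambda>s. t powr (real k + b - 1) * (((1/t) * s + 0) powr (real k + 1 - 1) * (1 - ((1/t) * s + 0)) powr (b - 1))"
  have "((\<lambda>s. s powr (real k + 1 - 1) * (1 - s) powr (b - 1)) has_integral Beta (real k + 1) b) (cbox 0 1)"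
    using has_integral_Beta_real[of "real k + 1" b] b by simp
  from has_integral_affinity'[OF this, of "1/t" 0] t
  have "((\<lambda>s. ((1/t) * s + 0) powr (real k + 1 - 1) * (1 - ((1/t) * s + 0)) powr (b - 1)) has_integral
       t * Beta (real k + 1) b) {0..t}"
    by simp
  from has_integral_mult_right[OF this, of "t powr (real k + b - 1)"]
  have "(?g has_integral t powr (real k + b - 1) * (t * Beta (real k + 1) b)) {0..t}" .
  moreover have "t powr (real k + b - 1) * (t * Beta (real k + 1) b) = Beta (real k + 1) b * t powr (real k + b)"
    using t by (simp add: powr_diff)
  ultimately have I: "(?g has_integral Beta (real k + 1) b * t powr (real k + b)) {0..t}"
    by simp
  \<comment> \<open>The endpoints are excluded because of \<open>0 powr 0 = 0\<close> versus \<open>0 ^ 0 = 1\<close>, and division by zero.\<close>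
  show ?thesis
  proof (rule has_integral_spike_finite[OF _ _ I])
    fix s assume "s \<in> {0..t} - {0, t}"
    then have s: "0 < s" "s < t" by auto
    have "1 - (1/t) * s = (t - s) / t" using t by (simp add: field_simps)
    then have "?g s = t powr (real k + b - 1) * ((s / t) powr real k * ((t - s) / t) powr (b - 1))"
      by simp
    also have "\<dots> = (t powr (real k + b - 1) / (t powr real k * t powr (b - 1))) * (s ^ k * (t - s) powr (b - 1))"
      using s t by (simp add: powr_divide powr_realpow)
    also have "t powr real k * t powr (b - 1) = t powr (real k + b - 1)"
      by (simp flip: powr_add add: algebra_simps)
    also have "t powr (real k + b - 1) / t powr (real k + b - 1) * (s ^ k * (t - s) powr (b - 1)) = s ^ k * (t - s) powr (b - 1)"
      using t by simp
    also have "\<dots> = s ^ k / (t - s) powr (1 - b)"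
      using powr_minus_divide[of "t - s" "1 - b"] by simp
    finally show "s ^ k / (t - s) powr (1 - b) = ?g s" by simp
  qed simp
qed

theorem theorem6:
  fixes \<alpha> t :: real and n m l :: nat
  assumes "\<alpha> > 0" and "n = nat \<lceil>\<alpha>\<rceil>" and "m \<ge> n" and "l \<ge> 1" and "t > 0"
  shows "caputo \<alpha> (bernoulli_poly l m) t =
    Gamma (real m + 1) / Gamma (real m - real n + 1) *
    (\<Sum>k=0..m - n. fact k * real ((m - n) choose k) / Gamma (real n + real k - \<alpha> + 1) *
       t powr (real k - \<alpha> + real n) *
       (\<Sum>s\<in>{s :: nat list. length s = l \<and> sum_list s = m - n - k}.
          multinomial (m - n - k) s * (\<Prod>j<l. bernoulli (s ! j))))"
proof -
  define N where "N = m - n"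
  \<comment> \<open>This stands for the inner multinomial sum with total \<open>j\<close>; it is
    expanded only at the very end.\<close>
  define c where "c j = fact j * fps_nth (bernoulli_fps ^ l) j" for j
  have m: "m = N + n" using assms(3) by (simp add: N_def)
  have G: "Gamma (real m + 1) = fact (N + n)" "Gamma (real m - real n + 1) = fact N"
    using Gamma_fact[of m, where 'a = real] Gamma_fact[of N, where 'a = real] by (simp_all add: m add_ac)
  have D: "(deriv ^^ n) (bernoulli_poly l m) =
      (\<lambda>x. fact (N + n) / fact N * (\<Sum>k\<le>N. real (N choose k) * c (N - k) * x ^ k))"
    using higher_deriv_appell[of n N c] by (simp add: bernoulli_poly_eq_sum[abs_def] c_def m)
  have "caputo \<alpha> (bernoulli_poly l m) t = fact (N + n) / fact N *
      (\<Sum>k\<le>N. fact k * real (N choose k) / Gamma (real n + real k - \<alpha> + 1) *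
         t powr (real k - \<alpha> + real n) * c (N - k))"
  proof (cases "\<alpha> = real n")
    \<comment> \<open>Here the Caputo derivative is the ordinary one: the Gamma value is k! and
      cancels, and \<open>powr\<close> becomes a natural power since \<open>t > 0\<close>.\<close>
    case True
    have "Gamma (real k + 1) = fact k" for k
      using Gamma_fact[of k, where 'a = real] by (simp add: add_ac)
    then have "fact k * real (N choose k) / Gamma (real n + real k - \<alpha> + 1) *
         t powr (real k - \<alpha> + real n) * c (N - k) = real (N choose k) * c (N - k) * t ^ k" for k
      using True assms(5) by (simp add: powr_realpow)
    then show ?thesis
      using True by (simp add: caputo_def D flip: assms(2))
  next
    case False
    \<comment> \<open>The kernel exponent \<alpha> - n + 1 equals 1 - b, and b > 0 because \<alpha>
      lies strictly below its ceiling.\<close>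
    define b where "b = real n - \<alpha>"
    have b: "b > 0"
      using False assms(1,2) unfolding b_def by linarith
    have "((\<lambda>s. \<Sum>k\<le>N. (fact (N + n) / fact N * (real (N choose k) * c (N - k))) *
          (s ^ k / (t - s) powr (1 - b))) has_integral
        (\<Sum>k\<le>N. (fact (N + n) / fact N * (real (N choose k) * c (N - k))) *
          (Beta (real k + 1) b * t powr (real k + b)))) {0..t}"
      by (intro has_integral_sum finite_atMost has_integral_mult_right
            has_integral_power_div_powr assms(5) b)
    also have "(\<lambda>s. \<Sum>k\<le>N. (fact (N + n) / fact N * (real (N choose k) * c (N - k))) *
          (s ^ k / (t - s) powr (1 - b))) =
        (\<lambda>s. (deriv ^^ n) (bernoulli_poly l m) s / (t - s) powr (\<alpha> - real n + 1))"
      by (simp add: D b_def sum_distrib_left sum_divide_distrib algebra_simps)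
    finally have "integral {0..t} (\<lambda>s. (deriv ^^ n) (bernoulli_poly l m) s / (t - s) powr (\<alpha> - real n + 1))
        = (\<Sum>k\<le>N. (fact (N + n) / fact N * (real (N choose k) * c (N - k))) *
          (Beta (real k + 1) b * t powr (real k + b)))"
      by (rule integral_unique)
    then have "caputo \<alpha> (bernoulli_poly l m) t = 1 / Gamma b *
        (\<Sum>k\<le>N. (fact (N + n) / fact N * (real (N choose k) * c (N - k))) *
          (Beta (real k + 1) b * t powr (real k + b)))"
      using False by (simp add: caputo_def b_def flip: assms(2))
    \<comment> \<open>Writing Beta(k+1,b) as k! Gamma(b) / Gamma(k+1+b) cancels the normalising
      factor 1/Gamma(b) in each term.\<close>
    also have "\<dots> = fact (N + n) / fact N *
      (\<Sum>k\<le>N. fact k * real (N choose k) / Gamma (real n + real k - \<alpha> + 1) *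
         t powr (real k - \<alpha> + real n) * c (N - k))"
      unfolding sum_distrib_left
    proof (intro sum.cong refl)
      fix k
      have "Gamma b \<noteq> 0" using Gamma_real_pos[OF b] by simp
      moreover have "Gamma (real k + 1) = fact k"
        using Gamma_fact[of k, where 'a = real] by (simp add: add_ac)
      moreover have *: "real n + real k - \<alpha> + 1 = real k + 1 + b" "real k - \<alpha> + real n = real k + b"
        by (simp_all add: b_def)
      ultimately show "1 / Gamma b * ((fact (N + n) / fact N * (real (N choose k) * c (N - k))) *
          (Beta (real k + 1) b * t powr (real k + b))) =
        fact (N + n) / fact N * (fact k * real (N choose k) / Gamma (real n + real k - \<alpha> + 1) *
         t powr (real k - \<alpha> + real n) * c (N - k))"
        unfolding * Beta_def by (simp add: mult_ac)
    qed
    finally show ?thesis .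
  qed
  then show ?thesis
    unfolding G c_def fact_mult_bernoulli_fps_power_nth[OF assms(4)] N_def[symmetric] atLeast0AtMost .
qed

end
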